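(* Let $\mathbf{E}=[\mathbf{F}\ \ \mathbf{G}]\in\mathbb{R}^{n_d\times n}$ with $\mathbf{F}\in\mathbb{R}^{n_d\times n_m}$, $\mathbf{G}\in\mathbb{R}^{n_d\times n_b}$, $n=n_m+n_b$. Let $\mathbf{M}=\begin{bmatrix}\mathbf{M}_1&0\\0&\mathbf{M}_2\end{bmatrix}$ with $\mathbf{M}_1\in\mathbb{R}^{n_m\times n_m}$, $\mathbf{M}_2\in\mathbb{R}^{n_b\times n_b}$ symmetric positive definite, and let $\boldsymbol\Gamma_{\mathrm{pr}}=\begin{bmatrix}\boldsymbol\Gamma_{\mathrm{pr},m}&0\\0&\boldsymbol\Gamma_{\mathrm{pr},b}\end{bmatrix}\in\mathbb{R}^{n\times n}$, where $\boldsymbol\Gamma_{\mathrm{pr},m}\in\mathbb{R}^{n_m\times n_m}$ and $\boldsymbol\Gamma_{\mathrm{pr},b}\in\mathbb{R}^{n_b\times n_b}$ are self-adjoint and positive definite with respect to the inner products $\langle\cdot,\cdot\rangle_{\mathbf{M}_1}$ and $\langle\cdot,\cdot\rangle_{\mathbf{M}_2}$, respectively. Let $\sigma_1,\dots,\sigma_{n_d}>0$, let $\mathbf{w}\in\mathbb{R}^{n_d}$ have non-negative entries (possibly zero), and let $\mathbf{W}_\sigma=\mathrm{diag}(w_1\sigma_1^{-2},\dots,w_{n_d}\sigma_{n_d}^{-2})$. Let $\mathbf{E}^*=\mathbf{M}^{-1}\mathbf{E}^\top$. Then the following relation holds (the existence of the inverses appearing in it being part of the assertion): $$(\mathbf{E}^*\mathbf{W}_\sigma\mathbf{E}+\boldsymbol\Gamma_{\mathrm{pr}}^{-1})^{-1}=\boldsymbol\Gamma_{\mathrm{pr}}-\boldsymbol\Gamma_{\mathrm{pr}}\mathbf{E}^*(\mathbf{I}+\mathbf{W}_\sigma\mathbf{E}\boldsymbol\Gamma_{\mathrm{pr}}\mathbf{E}^*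 )^{-1}\mathbf{W}_\sigma\mathbf{E}\boldsymbol\Gamma_{\mathrm{pr}}.$$
   Context: For a symmetric positive definite matrix $\mathbf{A}$, $\langle\mathbf{u},\mathbf{v}\rangle_{\mathbf{A}}=\mathbf{u}^\top\mathbf{A}\mathbf{v}$. $\mathbb{R}^n=\mathbb{R}^{n_m}\times\mathbb{R}^{n_b}$ carries the inner product $\langle\cdot,\cdot\rangle_{\mathbf{M}}$ and $\mathbb{R}^{n_d}$ the Euclidean inner product; $\mathbf{E}^*=\mathbf{M}^{-1}\mathbf{E}^\top$ is the adjoint of $\mathbf{E}:(\mathbb{R}^n,\langle\cdot,\cdot\rangle_{\mathbf{M}})\to\mathbb{R}^{n_d}$. A matrix $\mathbf{A}\in\mathbb{R}^{k\times k}$ is self-adjoint with respect to $\langle\cdot,\cdot\rangle_{\mathbf{B}}$ if $\mathbf{A}=\mathbf{B}^{-1}\mathbf{A}^\top\mathbf{B}$, and positive definite if $\langle\mathbf{A}\mathbf{u},\mathbf{u}\rangle_{\mathbf{B}}>0$ for all $\mathbf{u}\neq 0$. $\mathbf{I}$ denotes the identity matrix of the appropriate size. *)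

theory Defs
  imports "HOL-Analysis.Analysis"
begin

text \<open>
  Dimensions are finite index types. The space of dimension \<open>n = n\<^sub>m + n\<^sub>b\<close> is indexed by the
  sum type \<open>'m + 'b\<close>, the indices \<open>Inl\<close> belonging to the first block and \<open>Inr\<close> to the second.
\<close>

definition block_row :: "real^'m^'d \<Rightarrow> real^'b^'d \<Rightarrow> real^('m + 'b)^'d" where
  "block_row F G = (\<chi> i j. case j of Inl k \<Rightarrow> F $ i $ k | Inr l \<Rightarrow> G $ i $ l)"

definition block_diag :: "real^'m^'m \<Rightarrow> real^'b^'b \<Rightarrow> real^('m + 'b)^('m + 'b)" where
  "block_diag A B = (\<chi> i j.
     case i of
       Inl k \<Rightarrow> (case j of Inl k' \<Rightarrow> A $ k $ k' | Inr l' \<Rightarrow> 0)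
     | Inr l \<Rightarrow> (case j of Inl k' \<Rightarrow> 0 | Inr l' \<Rightarrow> B $ l $ l'))"

definition diag :: "real^'n \<Rightarrow> real^'n^'n" where
  "diag v = (\<chi> i j. if i = j then v $ i else 0)"

definition sym_pos_def :: "real^'n^'n \<Rightarrow> bool" where
  "sym_pos_def A \<longleftrightarrow> transpose A = A \<and> (\<forall>u. u \<noteq> 0 \<longrightarrow> u \<bullet> (A *v u) > 0)"

definition inner_wrt :: "real^'n^'n \<Rightarrow> real^'n \<Rightarrow> real^'n \<Rightarrow> real" where
  "inner_wrt A u v = u \<bullet> (A *v v)"

text \<open>
  In the following three definitions the first argument is the weight matrix of the inner product,
  meant to be symmetric positive definite; \<open>matrix_inv\<close> is an actual inverse only for an
  invertible argument.
\<close>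

definition self_adjoint_wrt :: "real^'n^'n \<Rightarrow> real^'n^'n \<Rightarrow> bool" where
  "self_adjoint_wrt B A \<longleftrightarrow> A = matrix_inv B ** transpose A ** B"

definition pos_def_wrt :: "real^'n^'n \<Rightarrow> real^'n^'n \<Rightarrow> bool" where
  "pos_def_wrt B A \<longleftrightarrow> (\<forall>u. u \<noteq> 0 \<longrightarrow> inner_wrt B (A *v u) u > 0)"

text \<open>
  Adjoint of \<open>E\<close> as a map from \<open>\<real>\<^sup>n\<close> with the \<open>M\<close>-weighted inner product to Euclidean space.
\<close>

definition adjoint_wrt :: "real^'n^'n \<Rightarrow> real^'n^'d \<Rightarrow> real^'d^'n" where
  "adjoint_wrt M E = matrix_inv M ** transpose E"

end

theory Submission
  imports Defs
begin

text \<open>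
  Since \<open>E\<^sup>* = M\<^sup>-\<^sup>1 E\<^sup>T\<close>, the matrix \<open>S = E \<Gamma> E\<^sup>*\<close> is a congruence of the positive definite
  \<open>\<Gamma> M\<^sup>-\<^sup>1\<close>. If \<open>x + W S x = 0\<close> then \<open>x \<bullet> S x = - (S x) \<bullet> W (S x) \<le> 0\<close>, which forces \<open>E\<^sup>T x = 0\<close>
  and hence \<open>x = 0\<close>; so \<open>I + W S\<close> is invertible even when \<open>W\<close> is singular. The claim is then the
  Woodbury identity, in the form that does not involve \<open>W\<^sup>-\<^sup>1\<close>.
\<close>

lemma invertible_if_trivial_kernel:
  fixes A :: "real^'n^'n"
  assumes "\<And>x. A *v x = 0 \<Longrightarrow> x = 0"
  shows "invertible A"
  using assms unfolding invertible_left_inverse matrix_left_invertible_ker by blast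

lemma matrix_inv_left_right:
  fixes A :: "real^'n^'n"
  assumes "invertible A"
  shows "matrix_inv A ** A = mat 1" "A ** matrix_inv A = mat 1"
  using someI_ex[OF assms[unfolded invertible_def]] by (simp_all add: matrix_inv_def)

text \<open>A one-sided inverse of a square matrix is two-sided, so verifying a single product
  yields both invertibility and the value of \<open>matrix_inv\<close>.\<close>

lemma matrix_inverse_eqI:
  fixes A B :: "real^'n^'n"
  assumes "A ** B = mat 1"
  shows "invertible A" "matrix_inv A = B"
proof -
  have BA: "B ** A = mat 1"
    using assms by (simp add: matrix_left_right_inverse)
  show inv: "invertible A"
    unfolding invertible_def using assms BA by blast
  have "matrix_inv A = matrix_inv A ** (A ** B)"
    by (simp add: assms)
  also have "\<dots> = B"
    by (simp add: matrix_mul_assoc matrix_inv_left_right(1) inv)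
  finally show "matrix_inv A = B" .
qed

lemma sum_UNIV_sum_type:
  fixes f :: "'a::finite + 'b::finite \<Rightarrow> 'c::comm_monoid_add"
  shows "(\<Sum>i\<in>UNIV. f i) = (\<Sum>k\<in>UNIV. f (Inl k)) + (\<Sum>l\<in>UNIV. f (Inr l))"
  by (simp flip: UNIV_Plus_UNIV add: sum.Plus)

lemma block_diag_mult_vec_Inl:
  "(block_diag A B *v u) $ Inl k = (A *v (\<chi> k. u $ Inl k)) $ k"
  by (simp add: block_diag_def matrix_vector_mult_def sum_UNIV_sum_type)

lemma block_diag_mult_vec_Inr:
  "(block_diag A B *v u) $ Inr l = (B *v (\<chi> l. u $ Inr l)) $ l"
  by (simp add: block_diag_def matrix_vector_mult_def sum_UNIV_sum_type)

text \<open>No cross terms arise: the weighted form of the block matrix at \<open>u\<close> is the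
  sum of the forms of the two blocks at the components of \<open>u\<close>.\<close>

lemma pos_def_wrt_block_diag:
  assumes "pos_def_wrt M1 A" and "pos_def_wrt M2 B"
  shows "pos_def_wrt (block_diag M1 M2) (block_diag A B)"
  unfolding pos_def_wrt_def
proof (intro allI impI)
  fix u :: "real^('a + 'b)"
  assume "u \<noteq> 0"
  define a where "a = (\<chi> k. u $ Inl k)"
  define b where "b = (\<chi> l. u $ Inr l)"
  have split: "inner_wrt (block_diag M1 M2) (block_diag A B *v u) u
      = inner_wrt M1 (A *v a) a + inner_wrt M2 (B *v b) b"
    by (simp add: inner_wrt_def inner_vec_def sum_UNIV_sum_type
        block_diag_mult_vec_Inl block_diag_mult_vec_Inr a_def b_def)
  \<comment> \<open>One component of \<open>u\<close> may vanish, so each summand is only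
    non-negative; strictness comes from whichever component is non-zero.\<close>
  have nonneg: "inner_wrt M1 (A *v a) a \<ge> 0" "inner_wrt M2 (B *v b) b \<ge> 0"
    using assms unfolding pos_def_wrt_def
    by (metis inner_wrt_def inner_zero_right matrix_vector_mult_0_right order.refl less_imp_le)+
  have "a \<noteq> 0 \<or> b \<noteq> 0"
  proof (rule ccontr)
    assume "\<not> (a \<noteq> 0 \<or> b \<noteq> 0)"
    then have "u $ i = 0" for i
      by (cases i) (auto simp: a_def b_def vec_eq_iff)
    with \<open>u \<noteq> 0\<close> show False
      by (simp add: vec_eq_iff)
  qed
  then show "inner_wrt (block_diag M1 M2) (block_diag A B *v u) u > 0"
    using assms nonneg unfolding split pos_def_wrt_def
    by (metis add_pos_nonneg add_nonneg_pos)
qed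

text \<open>The form at \<open>x\<close> is the Euclidean product of \<open>A *v x\<close> and
  \<open>M *v x\<close>, so a kernel vector of either matrix makes it vanish.\<close>

lemma pos_def_wrt_invertible:
  assumes "pos_def_wrt M A"
  shows "invertible M" "invertible A"
proof -
  show "invertible M"
  proof (rule invertible_if_trivial_kernel)
    fix x assume "M *v x = 0"
    then have "inner_wrt M (A *v x) x = 0" by (simp add: inner_wrt_def)
    then show "x = 0" using assms unfolding pos_def_wrt_def by (metis less_irrefl)
  qed
  show "invertible A"
  proof (rule invertible_if_trivial_kernel)
    fix x assume "A *v x = 0"
    then have "inner_wrt M (A *v x) x = 0" by (simp add: inner_wrt_def)
    then show "x = 0" using assms unfolding pos_def_wrt_def by (metis less_irrefl)
  qed
qed

lemma diag_inner_nonneg: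
  assumes "\<And>i. v $ i \<ge> 0"
  shows "y \<bullet> (diag v *v y) \<ge> 0"
proof -
  have "(diag v *v y) $ i = v $ i * y $ i" for i
  proof -
    have "(diag v *v y) $ i = (\<Sum>j\<in>UNIV. if i = j then v $ i * y $ j else 0)"
      by (simp add: diag_def matrix_vector_mult_def if_distrib[of "\<lambda>c. c * _"] cong: if_cong)
    then show ?thesis by simp
  qed
  then have "y \<bullet> (diag v *v y) = (\<Sum>i\<in>UNIV. v $ i * (y $ i * y $ i))"
    by (simp add: inner_vec_def mult_ac)
  also have "\<dots> \<ge> 0"
    by (intro sum_nonneg mult_nonneg_nonneg assms zero_le_square)
  finally show ?thesis .
qed

text \<open>Substituting \<open>z = M *v u\<close> turns the Euclidean form of
  \<open>A ** matrix_inv M\<close> at \<open>z\<close> into the \<open>M\<close>-weighted form of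
  \<open>A\<close> at \<open>u\<close>.\<close>

lemma pos_def_wrt_inverse_inner_pos:
  assumes "pos_def_wrt M A" and "z \<noteq> 0"
  shows "z \<bullet> (A *v (matrix_inv M *v z)) > 0"
proof -
  define u where "u = matrix_inv M *v z"
  have Mu: "M *v u = z"
    using pos_def_wrt_invertible(1)[OF assms(1)]
    by (simp add: u_def matrix_vector_mul_assoc matrix_inv_left_right(2))
  with assms(2) have "u \<noteq> 0" by auto
  with assms(1) have "inner_wrt M (A *v u) u > 0"
    by (simp add: pos_def_wrt_def)
  then show ?thesis
    by (simp add: inner_wrt_def Mu inner_commute flip: u_def)
qed

lemma invertible_mat_1_plus_psd_mult:
  fixes E :: "real^'n^'d"
  assumes "pos_def_wrt M A" and "\<And>y. y \<bullet> (W *v y) \<ge> 0"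
  shows "invertible (mat 1 + W ** E ** A ** adjoint_wrt M E)"
proof (rule invertible_if_trivial_kernel)
  fix x
  assume ker: "(mat 1 + W ** E ** A ** adjoint_wrt M E) *v x = 0"
  define z where "z = transpose E *v x"
  \<comment> \<open>\<open>y\<close> is the image of \<open>x\<close> under
    \<open>E ** A ** adjoint_wrt M E\<close>. The kernel equation becomes
    \<open>x = - (W *v y)\<close>, so semidefiniteness of \<open>W\<close> is tested at
    \<open>y\<close>, not at \<open>x\<close>.\<close>
  define y where "y = E *v (A *v (matrix_inv M *v z))"
  have x: "x + W *v y = 0"
    using ker
    by (simp add: matrix_vector_mult_add_rdistrib adjoint_wrt_def y_def z_def
        flip: matrix_vector_mul_assoc)
  have "z = 0"
  proof (rule ccontr)
    assume "z \<noteq> 0"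
    then have "0 < z \<bullet> (A *v (matrix_inv M *v z))"
      using assms(1) by (rule pos_def_wrt_inverse_inner_pos[rotated])
    also have "\<dots> = x \<bullet> y"
      by (simp add: y_def z_def dot_lmul_matrix)
    also have "\<dots> = - (y \<bullet> (W *v y))"
      using x by (metis add_eq_0_iff2 inner_commute inner_minus_left)
    finally show False
      using assms(2)[of y] by simp
  qed
  then show "x = 0"
    using x by (simp add: y_def)
qed

lemma matrix_add_rdistrib:
  fixes A B :: "'a::semiring_1^'n^'m"
  shows "(A + B) ** C = A ** C + B ** C"
  by (vector matrix_matrix_mult_def sum.distrib distrib_right)

lemma matrix_sub_ldistrib:
  fixes A :: "'a::ring_1^'n^'m"
  shows "A ** (B - C) = A ** B - A ** C"
  by (vector matrix_matrix_mult_def sum_subtractf right_diff_distrib)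

text \<open>With \<open>K = mat 1 + V ** A ** U\<close>, the first factor times
  \<open>A ** U\<close> equals \<open>U + U ** V ** A ** U = U ** K\<close>. Hence \<open>K\<close>
  cancels its inverse, the subtracted term becomes \<open>U ** V ** A\<close>, and
  \<open>mat 1\<close> remains.\<close>

lemma woodbury_right_inverse:
  fixes A :: "real^'n^'n" and U :: "real^'d^'n" and V :: "real^'n^'d"
  assumes "invertible A" and K: "invertible (mat 1 + V ** A ** U)"
  shows "(U ** V + matrix_inv A) ** (A - A ** U ** matrix_inv (mat 1 + V ** A ** U) ** V ** A)
    = mat 1"
proof -
  define K where "K = mat 1 + V ** A ** U"
  have AA: "matrix_inv A ** A = mat 1"
    using assms(1) by (rule matrix_inv_left_right(1))
  have KK: "K ** matrix_inv K = mat 1"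
    using K unfolding K_def by (rule matrix_inv_left_right(2))
  have left: "(U ** V + matrix_inv A) ** A = U ** V ** A + mat 1"
    by (simp add: matrix_add_rdistrib AA)
  have "(U ** V + matrix_inv A) ** (A - A ** U ** matrix_inv K ** V ** A)
      = (U ** V + matrix_inv A) ** A
        - (U ** V + matrix_inv A) ** A ** U ** matrix_inv K ** V ** A"
    by (simp add: matrix_sub_ldistrib matrix_mul_assoc)
  also have "(U ** V + matrix_inv A) ** A ** U = U ** K"
    by (simp add: K_def AA matrix_add_rdistrib matrix_add_ldistrib matrix_mul_assoc add.commute)
  also have "U ** K ** matrix_inv K = U"
    by (simp add: KK flip: matrix_mul_assoc)
  finally show ?thesis
    by (simp add: left K_def)
qed

theorem theorem3p1:
  fixes F :: "real^'m^'d" and G :: "real^'b^'d" and E :: "real^('m + 'b)^'d"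
    and M1 \<Gamma>m :: "real^'m^'m" and M2 \<Gamma>b :: "real^'b^'b"
    and M \<Gamma>pr :: "real^('m + 'b)^('m + 'b)"
    and \<sigma> w :: "real^'d" and W :: "real^'d^'d" and Es :: "real^'d^('m + 'b)"
  assumes "E = block_row F G"
    and "sym_pos_def M1" and "sym_pos_def M2"
    and "M = block_diag M1 M2"
    and "self_adjoint_wrt M1 \<Gamma>m" and "pos_def_wrt M1 \<Gamma>m"
    and "self_adjoint_wrt M2 \<Gamma>b" and "pos_def_wrt M2 \<Gamma>b"
    and "\<Gamma>pr = block_diag \<Gamma>m \<Gamma>b"
    and "\<And>i. \<sigma> $ i > 0"
    and "\<And>i. w $ i \<ge> 0"
    and "W = diag (\<chi> i. w $ i * (\<sigma> $ i) powi (-2))"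
    and "Es = adjoint_wrt M E"
  shows "invertible M
    \<and> invertible \<Gamma>pr
    \<and> invertible (Es ** W ** E + matrix_inv \<Gamma>pr)
    \<and> invertible (mat 1 + W ** E ** \<Gamma>pr ** Es)
    \<and> matrix_inv (Es ** W ** E + matrix_inv \<Gamma>pr)
        = \<Gamma>pr - \<Gamma>pr ** Es ** matrix_inv (mat 1 + W ** E ** \<Gamma>pr ** Es) ** W ** E ** \<Gamma>pr"
proof -
  have pd: "pos_def_wrt M \<Gamma>pr"
    using assms by (simp add: pos_def_wrt_block_diag)
  have psd: "y \<bullet> (W *v y) \<ge> 0" for y
    unfolding \<open>W = _\<close> by (rule diag_inner_nonneg) (simp add: assms zero_le_power_int less_imp_le)
  have M: "invertible M" and \<Gamma>: "invertible \<Gamma>pr"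
    using pos_def_wrt_invertible[OF pd] by auto
  have K: "invertible (mat 1 + W ** E ** \<Gamma>pr ** Es)"
    unfolding \<open>Es = _\<close> using pd psd by (rule invertible_mat_1_plus_psd_mult)
  have "(Es ** W ** E + matrix_inv \<Gamma>pr)
      ** (\<Gamma>pr - \<Gamma>pr ** Es ** matrix_inv (mat 1 + W ** E ** \<Gamma>pr ** Es) ** W ** E ** \<Gamma>pr) = mat 1"
    \<comment> \<open>The weight is absorbed into the right factor \<open>V = W ** E\<close>, so
      only \<open>\<Gamma>pr\<close> and \<open>K\<close> have to be inverted, never
      \<open>W\<close>.\<close>
    using woodbury_right_inverse[OF \<Gamma>, of "W ** E" Es] K by (simp add: matrix_mul_assoc)
  from matrix_inverse_eqI[OF this] M \<Gamma> K show ?thesis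
    by blast
qed

end
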